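(* Let $a_0,a_1,\alpha,\beta,u,v\in\mathbb{R}$ with $\alpha\beta\neq 0$, $uv\neq 0$ and $|a_0|+|a_1|\neq 0$, and let $(a_{n,k})_{0\le k\le n}$ be the binary binomial interpolated triangle with parameters $(a_0,a_1,\alpha,\beta;u,v)$. Put $\mathcal{A}=u\alpha+2v$ and $\mathcal{B}=u^2\beta-uv\alpha-v^2$. For $n\ge 0$ let $$d_n=\sum_{k=0}^{\lfloor n/2\rfloor}a_{n-k,k}$$ be the sum of the entries of the $n$-th rising diagonal, and for $n\ge 2$ put $D_n=-d_n+\alpha d_{n-1}+\beta d_{n-2}$. Then $$D_n=\mathcal{A}D_{n-2}+\mathcal{B}D_{n-4}\qquad\text{for all } n\ge 6,$$ which is a sixth order linear recurrence relation for the sequence $(d_n)_{n\ge 0}$. Moreover, for every even $n=2k\ge 2$ one has $D_n=-b_k$, where $b_k=a_{k,k}$.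
   Context: The binary binomial interpolated triangle with parameters $(a_0,a_1,\alpha,\beta;u,v)$ is the array of real numbers $a_{n,k}$ ($0\le k\le n$) defined as follows. Its left diagonal is $a_{n,0}=a_n$, where $(a_n)_{n\ge0}$ has initial values $a_0,a_1$ and satisfies $a_n=\alpha a_{n-1}+\beta a_{n-2}$ for $n\ge 2$. The other entries are given by $a_{n,k}=u\,a_{n,k-1}+v\,a_{n-1,k-1}$ for $1\le k\le n$. The sequence $b_n=a_{n,n}$ is called the right diagonal sequence. *)

theory Defs
  imports Complex_Main
begin

fun left_diagonal :: "real \<Rightarrow> real \<Rightarrow> real \<Rightarrow> real \<Rightarrow> nat \<Rightarrow> real" where
  "left_diagonal a0 a1 \<alpha> \<beta> 0 = a0"
| "left_diagonal a0 a1 \<alpha> \<beta> (Suc 0) = a1"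
| "left_diagonal a0 a1 \<alpha> \<beta> (Suc (Suc n)) =
     \<alpha> * left_diagonal a0 a1 \<alpha> \<beta> (Suc n) + \<beta> * left_diagonal a0 a1 \<alpha> \<beta> n"

text \<open>
  The first index is the row \<open>n\<close>, the second the position \<open>k\<close> in that row. Only the entries with
  \<open>k \<le> n\<close> belong to the triangle. Their recursion never leaves this range, so the values that the
  total function takes for \<open>k > n\<close> are irrelevant.
\<close>

fun interpolated_triangle ::
  "real \<Rightarrow> real \<Rightarrow> real \<Rightarrow> real \<Rightarrow> real \<Rightarrow> real \<Rightarrow> nat \<Rightarrow> nat \<Rightarrow> real" where
  "interpolated_triangle a0 a1 \<alpha> \<beta> u v n 0 = left_diagonal a0 a1 \<alpha> \<beta> n"
| "interpolated_triangle a0 a1 \<alpha> \<beta> u v 0 (Suc k) = 0"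
| "interpolated_triangle a0 a1 \<alpha> \<beta> u v (Suc n) (Suc k) =
     u * interpolated_triangle a0 a1 \<alpha> \<beta> u v (Suc n) k
     + v * interpolated_triangle a0 a1 \<alpha> \<beta> u v n k"

definition right_diagonal :: "(nat \<Rightarrow> nat \<Rightarrow> real) \<Rightarrow> nat \<Rightarrow> real" where
  "right_diagonal a n = a n n"

definition rising_diagonal_sum :: "(nat \<Rightarrow> nat \<Rightarrow> real) \<Rightarrow> nat \<Rightarrow> real" where
  "rising_diagonal_sum a n = (\<Sum>k = 0..n div 2. a (n - k) k)"

end

theory Submission imports Defs begin

text \<open>
  Every column of the triangle inherits the recurrence of the left diagonal, so in \<open>D n\<close> all columns
  cancel except the last one, where the recurrence would reach outside the triangle. This leaves
  \<open>- a m m\<close> for \<open>n = 2 * m\<close> and \<open>\<alpha> * a m m - a (m + 1) m\<close> for \<open>n = 2 * m + 1\<close>. The pair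
  \<open>(a m m, a (m + 1) m)\<close> evolves under a constant \<open>2 \<times> 2\<close> matrix with trace \<open>A\<close> and
  determinant \<open>- B\<close>, so Cayley--Hamilton gives the recurrence for both parities.
\<close>

text \<open>Column \<open>Suc k\<close> is a fixed linear combination of column \<open>k\<close> and
  its shift by one row, so a constant-coefficient recurrence passes on. The bound
  \<open>k \<le> n\<close> keeps even the lowest entry inside the triangle.\<close>

lemma interpolated_triangle_column_rec:
  assumes "k \<le> n"
  shows "interpolated_triangle a0 a1 \<alpha> \<beta> u v (Suc (Suc n)) k
    = \<alpha> * interpolated_triangle a0 a1 \<alpha> \<beta> u v (Suc n) k
      + \<beta> * interpolated_triangle a0 a1 \<alpha> \<beta> u v n k"
  using assms
proof (induction k arbitrary: n)
  case (Suc k)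
  then obtain m where "n = Suc m" "k \<le> m"
    by (cases n) auto
  with Suc.IH[of m] Suc.IH[of "Suc m"] show ?case
    by (simp add: algebra_simps)
qed simp

text \<open>Among the three sums only the first reaches column \<open>Suc m\<close>, so its last
  term is left over.\<close>

lemma rising_diagonal_sum_even:
  assumes "\<And>n k. k \<le> n \<Longrightarrow> a (Suc (Suc n)) k = \<alpha> * a (Suc n) k + \<beta> * a n k"
  shows "rising_diagonal_sum a (2 * m + 2)
    = \<alpha> * rising_diagonal_sum a (2 * m + 1) + \<beta> * rising_diagonal_sum a (2 * m)
      + a (Suc m) (Suc m)"
proof -
  have "a (2 * m + 2 - k) k = \<alpha> * a (2 * m + 1 - k) k + \<beta> * a (2 * m - k) k" if "k \<le> m" for k
    using that assms[of k "2 * m - k"] by (simp add: Suc_diff_le numeral_2_eq_2)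
  then have "(\<Sum>k = 0..m. a (2 * m + 2 - k) k)
    = \<alpha> * (\<Sum>k = 0..m. a (2 * m + 1 - k) k) + \<beta> * (\<Sum>k = 0..m. a (2 * m - k) k)"
    by (simp add: sum.distrib sum_distrib_left)
  then show ?thesis
    by (simp add: rising_diagonal_sum_def)
qed

lemma rising_diagonal_sum_odd:
  assumes "\<And>n k. k \<le> n \<Longrightarrow> a (Suc (Suc n)) k = \<alpha> * a (Suc n) k + \<beta> * a n k"
  shows "rising_diagonal_sum a (2 * m + 3)
    = \<alpha> * rising_diagonal_sum a (2 * m + 2) + \<beta> * rising_diagonal_sum a (2 * m + 1)
      + a (Suc (Suc m)) (Suc m) - \<alpha> * a (Suc m) (Suc m)"
proof -
  \<comment> \<open>Column \<open>Suc m\<close> must be split off: it occurs in the first two sums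
    but not in the third, since \<open>k \<le> 2 * m + 1 - k\<close> fails there.\<close>
  have "a (2 * m + 3 - k) k = \<alpha> * a (2 * m + 2 - k) k + \<beta> * a (2 * m + 1 - k) k" if "k \<le> m" for k
    using that assms[of k "2 * m + 1 - k"] by (simp add: Suc_diff_le eval_nat_numeral)
  then have "(\<Sum>k = 0..m. a (2 * m + 3 - k) k)
    = \<alpha> * (\<Sum>k = 0..m. a (2 * m + 2 - k) k) + \<beta> * (\<Sum>k = 0..m. a (2 * m + 1 - k) k)"
    by (simp add: sum.distrib sum_distrib_left)
  moreover have "(2 * m + 3) div 2 = Suc m" "2 * m + 3 - Suc m = Suc (Suc m)"
    by simp_all
  ultimately show ?thesis
    by (simp add: rising_diagonal_sum_def algebra_simps)
qed

theorem theorem9: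
  fixes a0 a1 \<alpha> \<beta> u v A B :: real
    and a :: "nat \<Rightarrow> nat \<Rightarrow> real"
    and b d D :: "nat \<Rightarrow> real"
  assumes "\<alpha> * \<beta> \<noteq> 0" and "u * v \<noteq> 0" and "\<bar>a0\<bar> + \<bar>a1\<bar> \<noteq> 0"
    and "a = interpolated_triangle a0 a1 \<alpha> \<beta> u v"
    and "b = right_diagonal a"
    and "d = rising_diagonal_sum a"
    and "A = u * \<alpha> + 2 * v"
    and "B = u\<^sup>2 * \<beta> - u * v * \<alpha> - v\<^sup>2"
    and "\<And>n. n \<ge> 2 \<Longrightarrow> D n = - d n + \<alpha> * d (n - 1) + \<beta> * d (n - 2)"
  shows "(\<forall>n\<ge>6. D n = A * D (n - 2) + B * D (n - 4))
    \<and> (\<forall>n\<ge>6. d n = \<alpha> * d (n - 1) + (A + \<beta>) * d (n - 2) - A * \<alpha> * d (n - 3)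
          + (B - A * \<beta>) * d (n - 4) - B * \<alpha> * d (n - 5) - B * \<beta> * d (n - 6))
    \<and> (\<forall>n k. n = 2 * k \<and> n \<ge> 2 \<longrightarrow> D n = - b k)"
proof -
  have col: "a (Suc (Suc n)) k = \<alpha> * a (Suc n) k + \<beta> * a n k" if "k \<le> n" for n k
    using that unfolding assms(4) by (rule interpolated_triangle_column_rec)
  have tri: "a (Suc n) (Suc k) = u * a (Suc n) k + v * a n k" for n k
    by (simp add: assms(4))
  have D: "D (n + 2) = - d (n + 2) + \<alpha> * d (n + 1) + \<beta> * d n" for n
    using assms(9)[of "n + 2"] by simp
  have even: "D (2 * m + 2) = - a (Suc m) (Suc m)" for m
    using D[of "2 * m"] rising_diagonal_sum_even[of a, OF col] unfolding assms(6) by simp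
  have odd: "D (2 * m + 3) = \<alpha> * a (Suc m) (Suc m) - a (Suc (Suc m)) (Suc m)" for m
    using D[of "2 * m + 1"] rising_diagonal_sum_odd[of a, OF col] unfolding assms(6)
    by (simp add: eval_nat_numeral)
  have b_step: "a (Suc m) (Suc m) = u * a (Suc m) m + v * a m m" for m
    by (rule tri)
  \<comment> \<open>The column recurrence is applied at its boundary case, where the lowest entry is
    \<open>a m m\<close>. Together with \<open>b_step\<close> this gives the matrix with rows
    \<open>(v, u)\<close> and \<open>(u * \<beta>, u * \<alpha> + v)\<close>.\<close>
  have e_step: "a (Suc (Suc m)) (Suc m) = u * \<beta> * a m m + (u * \<alpha> + v) * a (Suc m) m" for m
    unfolding tri[of "Suc m" m] col[OF order_refl] by (simp add: algebra_simps)
  have b_rec: "a (Suc (Suc m)) (Suc (Suc m)) = A * a (Suc m) (Suc m) + B * a m m" for m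
    unfolding b_step[of "Suc m"] e_step[of m] b_step[of m] assms(7,8)
    by (simp add: algebra_simps power2_eq_square)
  have e_rec: "a (Suc (Suc (Suc m))) (Suc (Suc m)) = A * a (Suc (Suc m)) (Suc m) + B * a (Suc m) m" for m
    unfolding e_step[of "Suc m"] e_step[of m] b_step[of m] assms(7,8)
    by (simp add: algebra_simps power2_eq_square)
  have D_rec: "D (n + 6) = A * D (n + 4) + B * D (n + 2)" for n
  proof (cases "even n")
    case True
    then obtain m where "n = 2 * m" ..
    then show ?thesis
      using even[of m] even[of "Suc m"] even[of "Suc (Suc m)"] b_rec[of "Suc m"]
      by (simp add: eval_nat_numeral)
  next
    case False
    then obtain m where n: "n = 2 * m + 1" ..
    \<comment> \<open>Moving two places in \<open>D\<close> moves \<open>m\<close> by one, and each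
      value is the same linear combination of two sequences obeying one recurrence.\<close>
    have D_n: "D (n + 2) = \<alpha> * a (Suc m) (Suc m) - a (Suc (Suc m)) (Suc m)"
      "D (n + 4) = \<alpha> * a (Suc (Suc m)) (Suc (Suc m)) - a (Suc (Suc (Suc m))) (Suc (Suc m))"
      "D (n + 6) = \<alpha> * a (Suc (Suc (Suc m))) (Suc (Suc (Suc m)))
         - a (Suc (Suc (Suc (Suc m)))) (Suc (Suc (Suc m)))"
      using odd[of m] odd[of "Suc m"] odd[of "Suc (Suc m)"] n by (simp_all add: eval_nat_numeral)
    show ?thesis
      unfolding D_n b_rec[of "Suc m"] e_rec[of "Suc m"] by (simp add: algebra_simps)
  qed
  have "D n = A * D (n - 2) + B * D (n - 4)" if "n \<ge> 6" for n
  proof -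
    obtain k where "n = k + 6"
      using \<open>n \<ge> 6\<close> le_Suc_ex by (metis add.commute)
    with D_rec[of k] show ?thesis
      by (simp add: eval_nat_numeral)
  qed
  moreover have "d n = \<alpha> * d (n - 1) + (A + \<beta>) * d (n - 2) - A * \<alpha> * d (n - 3)
      + (B - A * \<beta>) * d (n - 4) - B * \<alpha> * d (n - 5) - B * \<beta> * d (n - 6)" if "n \<ge> 6" for n
  proof -
    obtain k where n: "n = k + 6"
      using \<open>n \<ge> 6\<close> le_Suc_ex by (metis add.commute)
    \<comment> \<open>Solve the definition of \<open>D (k + 6)\<close> for \<open>d (k + 6)\<close>;
      expanding the two remaining \<open>D\<close> values reaches down to \<open>d k\<close>, hence
      order six.\<close>
    have d6: "d (k + 6) = \<alpha> * d (k + 5) + \<beta> * d (k + 4) - (A * D (k + 4) + B * D (k + 2))"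
      using D_rec[of k] D[of "k + 4"] by (simp add: eval_nat_numeral)
    have D4: "D (k + 4) = - d (k + 4) + \<alpha> * d (k + 3) + \<beta> * d (k + 2)"
      using D[of "k + 2"] by (simp add: eval_nat_numeral)
    have "d (k + 6) = \<alpha> * d (k + 5) + (A + \<beta>) * d (k + 4) - A * \<alpha> * d (k + 3)
        + (B - A * \<beta>) * d (k + 2) - B * \<alpha> * d (k + 1) - B * \<beta> * d k"
      unfolding d6 D4 D[of k] by (simp add: algebra_simps)
    then show ?thesis
      unfolding n by (simp add: eval_nat_numeral)
  qed
  \<comment> \<open>Here \<open>n \<ge> 2\<close> forces \<open>k > 0\<close>, so
    \<open>k - 1\<close> is a true predecessor.\<close>
  moreover have "D n = - b k" if "n = 2 * k \<and> n \<ge> 2" for n k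
    using that even[of "k - 1"] unfolding assms(5) right_diagonal_def by (cases k) auto
  ultimately show ?thesis
    by blast
qed

end
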